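(* Let $A \in M_n(\mathbb{C})$ be a core-EP matrix. Then the following conditions are equivalent: (1) the DMP inverse of $A$ equals the Drazin inverse of $A$, i.e. $A^{d,\dagger} = A^{d}$; (2) the MPD inverse of $A$ equals the Drazin inverse of $A$, i.e. $A^{\dagger,d} = A^{d}$.
   Context: $A^{\dagger}$ is the Moore-Penrose inverse and $A^{d}$ the Drazin inverse of $A$. The core part of $A$ is $A_c = AA^{d}A$. A matrix $A$ is called core-EP if $A^{\dagger}A_c = A_cA^{\dagger}$. The DMP inverse is $A^{d,\dagger} = A^{d}AA^{\dagger}$ and the MPD inverse is $A^{\dagger,d} = A^{\dagger}AA^{d}$. *)

theory Defs
  imports "HOL-Analysis.Analysis"
begin

text \<open>Multiplication and power from the type classes act componentwise on the type
  \<open>complex ^ 'n ^ 'n\<close>, so matrix powers are defined here from the matrix product \<open>**\<close>.\<close>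

primrec mat_power :: "complex ^ 'n ^ 'n \<Rightarrow> nat \<Rightarrow> complex ^ 'n ^ 'n" where
  "mat_power A 0 = mat 1"
| "mat_power A (Suc k) = A ** mat_power A k"

definition conj_transpose :: "complex ^ 'n ^ 'm \<Rightarrow> complex ^ 'm ^ 'n" where
  "conj_transpose A = map_matrix cnj (transpose A)"

definition is_moore_penrose :: "complex ^ 'n ^ 'n \<Rightarrow> complex ^ 'n ^ 'n \<Rightarrow> bool" where
  "is_moore_penrose A X \<longleftrightarrow>
     A ** X ** A = A \<and>
     X ** A ** X = X \<and>
     conj_transpose (A ** X) = A ** X \<and>
     conj_transpose (X ** A) = X ** A"

definition moore_penrose :: "complex ^ 'n ^ 'n \<Rightarrow> complex ^ 'n ^ 'n" where
  "moore_penrose A = (THE X. is_moore_penrose A X)"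

text \<open>The index is \<open>0\<close> exactly for invertible matrices.\<close>

definition mat_index :: "complex ^ 'n ^ 'n \<Rightarrow> nat" where
  "mat_index A = (LEAST k. rank (mat_power A (Suc k)) = rank (mat_power A k))"

definition is_drazin :: "complex ^ 'n ^ 'n \<Rightarrow> complex ^ 'n ^ 'n \<Rightarrow> bool" where
  "is_drazin A X \<longleftrightarrow>
     X ** A ** X = X \<and>
     A ** X = X ** A \<and>
     mat_power A (Suc (mat_index A)) ** X = mat_power A (mat_index A)"

definition drazin :: "complex ^ 'n ^ 'n \<Rightarrow> complex ^ 'n ^ 'n" where
  "drazin A = (THE X. is_drazin A X)"

definition core_part :: "complex ^ 'n ^ 'n \<Rightarrow> complex ^ 'n ^ 'n" where
  "core_part A = A ** drazin A ** A"

definition core_EP :: "complex ^ 'n ^ 'n \<Rightarrow> bool" where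
  "core_EP A \<longleftrightarrow> moore_penrose A ** core_part A = core_part A ** moore_penrose A"

definition DMP_inverse :: "complex ^ 'n ^ 'n \<Rightarrow> complex ^ 'n ^ 'n" where
  "DMP_inverse A = drazin A ** A ** moore_penrose A"

definition MPD_inverse :: "complex ^ 'n ^ 'n \<Rightarrow> complex ^ 'n ^ 'n" where
  "MPD_inverse A = moore_penrose A ** A ** drazin A"

end

theory Submission
  imports Defs
begin

text \<open>Apart from \<open>D A D = D\<close> and \<open>A D = D A\<close> for the Drazin inverse \<open>D\<close>, no property of the
  Moore--Penrose inverse \<open>M\<close> is used: the core-EP condition reads \<open>M A A D = A A D M = A D A M\<close>, so
  \<open>D A M = D\<close> gives \<open>M A A D = A D\<close>, and multiplying by \<open>D\<close> on the right gives \<open>M A D = D\<close>; the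
  converse is symmetric.  What remains is that the definite description \<open>drazin A\<close> denotes.
  The row spaces of the powers of \<open>A\<close> and of its transpose stabilise, so that
  \<open>P = A^n\<close> satisfies \<open>P = z A P^2 = P^2 A y\<close> for large \<open>n\<close>; then \<open>z P = P y\<close> is the Drazin inverse.\<close>

lemma mat_power_add: "mat_power A (m + n) = mat_power A m ** mat_power A n"
  by (induction m) (simp_all add: matrix_mul_assoc)

lemma mat_power_commute: "mat_power A n ** A = A ** mat_power A n"
  using mat_power_add[of A n 1] by (simp add: add.commute)

lemma transpose_mat_power: "transpose (mat_power A n) = mat_power (transpose A) n"
  by (induction n) (simp_all add: transpose_mat matrix_transpose_mul mat_power_commute)

lemma rows_subset_range: "rows M \<subseteq> range (\<lambda>x. x v* M)"
  for M :: "'a::field ^ 'n ^ 'm"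
proof -
  have "row i M = axis i 1 v* M" for i
    by (simp add: row_def vector_matrix_mult_def axis_def vec_eq_iff if_distrib[of "\<lambda>c. c * _"]
        cong: if_cong)
  then show ?thesis
    by (auto simp: rows_def)
qed

text \<open>Since \<open>x v* M\<close> is \<open>transpose M *v x\<close>, the facts about column
  spaces apply to \<open>transpose M\<close>.\<close>

lemma span_rows: "vec.span (rows M) = range (\<lambda>x. x v* M)"
  for M :: "'a::field ^ 'n ^ 'm"
proof
  have "vec.subspace (range (\<lambda>x. x v* M))"
    using vec.subspace_image[OF vec.subspace_UNIV, of "transpose M"] by simp
  then show "vec.span (rows M) \<subseteq> range (\<lambda>x. x v* M)"
    by (intro vec.span_minimal rows_subset_range)
  show "range (\<lambda>x. x v* M) \<subseteq> vec.span (rows M)"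
    using matrix_vector_mult_in_columnspace_gen[of "transpose M"] by (auto simp: columns_transpose)
qed

lemma row_mult: "row i (B ** M) = row i B v* M"
  by (simp add: row_def matrix_matrix_mult_def vector_matrix_mult_def vec_eq_iff mult.commute)

lemma rows_mult_subset: "rows (B ** M) \<subseteq> vec.span (rows M)"
  for M :: "'a::field ^ 'n ^ 'm"
  by (auto simp: rows_def[of "B ** M"] row_mult span_rows)

lemma rank_mult_le_right: "rank (B ** M) \<le> rank M"
  for M :: "'a::field ^ 'n ^ 'm"
  unfolding row_rank_def_gen
  using vec.dim_subset[OF rows_mult_subset] by simp

text \<open>The row space of \<open>B ** M\<close> lies in that of \<open>M\<close>, and equal
  dimensions make them coincide. So each row of \<open>M\<close> is some
  \<open>x v* (B ** M)\<close>, and these \<open>x\<close> are the rows of \<open>Z\<close>.\<close>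

lemma left_factor_of_rank_eq:
  fixes M :: "'a::field ^ 'n ^ 'm"
  assumes "rank (B ** M) = rank M"
  shows "\<exists>Z. M = Z ** (B ** M)"
proof -
  have "vec.span (rows (B ** M)) = vec.span (rows M)"
    using assms vec.span_minimal[OF rows_mult_subset vec.subspace_span]
    by (intro vec.subspace_dim_equal) (auto simp: row_rank_def_gen)
  then have "row i M \<in> range (\<lambda>x. x v* (B ** M))" for i
    unfolding span_rows[symmetric] by (auto simp: rows_def intro: vec.span_base)
  then have "\<forall>i. \<exists>x. row i M = x v* (B ** M)"
    by blast
  then obtain f where f: "\<And>i. row i M = f i v* (B ** M)"
    by metis
  have "row i (vec_lambda f) = f i" for i
    by (simp add: row_def vec_eq_iff)
  then have "row i (vec_lambda f ** (B ** M)) = row i M" for i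
    by (simp add: row_mult f)
  then have "M = vec_lambda f ** (B ** M)"
    by (simp add: row_def vec_eq_iff)
  then show ?thesis ..
qed

text \<open>The \<open>LEAST\<close> is attained: ranks of powers never increase with the exponent,
  so an exponent of minimal rank qualifies.\<close>

lemma rank_mat_index: "rank (mat_power A (Suc (mat_index A))) = rank (mat_power A (mat_index A))"
proof -
  define r where "r k = rank (mat_power A k)" for k
  have "\<exists>k. r (Suc k) = r k"
  proof -
    obtain k where k: "\<And>j. r k \<le> r j"
      using ex_has_least_nat[of "\<lambda>_. True" 0 r] by auto
    have "r (Suc k) \<le> r k"
      by (simp add: r_def rank_mult_le_right)
    with k[of "Suc k"] show ?thesis
      by (intro exI[of _ k]) simp
  qed
  then show ?thesis
    unfolding mat_index_def r_def by (rule LeastI_ex)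
qed

lemma mat_power_left_factor:
  assumes "mat_index A \<le> n"
  shows "\<exists>Z. mat_power A n = Z ** mat_power A (n + j)"
proof (induction j)
  case 0
  show ?case
    by (rule exI[of _ "mat 1"]) simp
next
  case (Suc j)
  let ?k = "mat_index A"
  obtain Z where Z: "mat_power A n = Z ** mat_power A (n + j)"
    using Suc by blast
  obtain W where W: "mat_power A ?k = W ** mat_power A (Suc ?k)"
    using left_factor_of_rank_eq[of A "mat_power A ?k"] rank_mat_index[of A]
    unfolding mat_power.simps by blast
  \<comment> \<open>Multiplication by \<open>mat_power A d\<close> on the right carries the equation
    for \<open>W\<close> from exponent \<open>?k\<close> to exponent \<open>n + j\<close>.\<close>
  define d where "d = n + j - ?k"
  have d: "n + j = ?k + d" "n + Suc j = Suc ?k + d"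
    using assms by (auto simp: d_def)
  have "mat_power A (n + j) = W ** mat_power A (n + Suc j)"
    unfolding d mat_power_add by (metis W matrix_mul_assoc)
  with Z have "mat_power A n = (Z ** W) ** mat_power A (n + Suc j)"
    by (simp only: matrix_mul_assoc)
  then show ?case ..
qed

text \<open>Transposition turns left factors into right ones, hence the index of
  \<open>transpose A\<close>.\<close>

lemma mat_power_right_factor:
  assumes "mat_index (transpose A) \<le> n"
  shows "\<exists>Y. mat_power A n = mat_power A (n + j) ** Y"
proof -
  obtain Z where "mat_power (transpose A) n = Z ** mat_power (transpose A) (n + j)"
    using mat_power_left_factor[OF assms] by blast
  then have "mat_power A n = mat_power A (n + j) ** transpose Z"
    by (metis matrix_transpose_mul transpose_mat_power transpose_transpose)
  then show ?thesis ..
qed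

lemma is_drazin_exists: "\<exists>D. is_drazin A D"
proof -
  define k where "k = mat_index A"
  \<comment> \<open>Large enough for both a left and a right factor of
    \<open>mat_power A n\<close>.\<close>
  define n where "n = max k (mat_index (transpose A))"
  define P where "P = mat_power A n"
  have comm: "P ** A = A ** P"
    by (simp add: P_def mat_power_commute)
  have "P ** (A ** P) = P ** P ** A"
    by (simp add: comm flip: matrix_mul_assoc)
  then have PPA: "mat_power A (n + Suc n) = P ** P ** A"
    by (simp only: mat_power_add mat_power.simps flip: P_def)
  have n: "k \<le> n" "mat_index (transpose A) \<le> n"
    by (simp_all add: n_def)
  obtain z where z: "P = z ** (P ** P ** A)"
    using mat_power_left_factor[OF n(1)[unfolded k_def], of "Suc n"]
    unfolding PPA P_def[symmetric] by blast
  obtain y where y: "P = P ** P ** A ** y"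
    using mat_power_right_factor[OF n(2), of "Suc n"]
    unfolding PPA P_def[symmetric] by blast
  define D where "D = P ** y"
  have "D = z ** (P ** P ** A) ** y"
    unfolding z[symmetric] D_def ..
  also have "\<dots> = z ** (P ** P ** A ** y)"
    by (simp only: matrix_mul_assoc)
  also have "\<dots> = z ** P"
    unfolding y[symmetric] ..
  finally have D': "D = z ** P" .
  have "A ** D = P ** A ** y"
    by (simp add: D_def matrix_mul_assoc comm)
  also have "\<dots> = z ** (P ** P ** A) ** A ** y"
    unfolding z[symmetric] ..
  also have "\<dots> = z ** A ** (P ** P ** A ** y)"
  proof -
    \<comment> \<open>One \<open>A\<close> moves to the front, which leaves the product that equals
      \<open>P\<close> by the choice of \<open>y\<close>.\<close>
    have "P ** P ** A ** A = A ** P ** P ** A"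
      by (metis comm matrix_mul_assoc)
    then show ?thesis
      by (metis matrix_mul_assoc)
  qed
  also have "\<dots> = z ** A ** P"
    unfolding y[symmetric] ..
  also have "\<dots> = D ** A"
    by (simp add: D' comm flip: matrix_mul_assoc)
  finally have ADDA: "A ** D = D ** A" .
  have "D ** A ** D = z ** (P ** P ** A) ** y"
    by (subst D', subst D_def) (metis comm matrix_mul_assoc)
  then have DAD: "D ** A ** D = D"
    unfolding z[symmetric] by (simp add: D_def)
  have "P ** A ** D = P ** P ** A ** y"
    unfolding D_def by (metis comm matrix_mul_assoc)
  then have PAD: "P ** A ** D = P"
    unfolding y[symmetric] .
  \<comment> \<open>\<open>is_drazin\<close> asks for the power identity at the index
    \<open>k\<close>, which may be below \<open>n\<close>; the left factor \<open>Z\<close> brings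
    it down from \<open>P\<close>.\<close>
  obtain Z where Z: "mat_power A k = Z ** P"
    using mat_power_left_factor[of A k "n - k"] n(1)
    unfolding k_def P_def le_add_diff_inverse[OF n(1)[unfolded k_def]] by blast
  have "mat_power A (Suc k) ** D = mat_power A k ** A ** D"
    by (simp add: mat_power_commute)
  also have "\<dots> = Z ** (P ** A ** D)"
    by (simp add: Z matrix_mul_assoc)
  also have "\<dots> = mat_power A k"
    by (simp add: PAD Z)
  finally show ?thesis
    using ADDA DAD unfolding is_drazin_def k_def by blast
qed

text \<open>Iterates \<open>X = A ** X ** X\<close>; commutation then allows either order of the
  powers.\<close>

lemma is_drazin_power_eq:
  assumes "X ** A ** X = X" "A ** X = X ** A"
  shows "X = mat_power X (Suc n) ** mat_power A n" "X = mat_power A n ** mat_power X (Suc n)"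
proof -
  have comm: "mat_power A n ** X = X ** mat_power A n" for n
    by (induction n) (simp_all, metis assms(2) matrix_mul_assoc)
  have "X = mat_power A n ** mat_power X (Suc n)" for n
  proof (induction n)
    case (Suc n)
    have "mat_power A (Suc n) ** mat_power X (Suc (Suc n))
        = A ** (mat_power A n ** X) ** mat_power X (Suc n)"
      by (simp add: matrix_mul_assoc)
    also have "\<dots> = A ** X ** (mat_power A n ** mat_power X (Suc n))"
      by (simp only: comm matrix_mul_assoc)
    also have "\<dots> = X"
      unfolding Suc[symmetric] using assms by simp
    finally show ?case ..
  qed simp
  then show *: "X = mat_power A n ** mat_power X (Suc n)" .
  have "mat_power A n ** mat_power X j = mat_power X j ** mat_power A n" for j
    by (induction j) (simp_all, metis comm matrix_mul_assoc)
  with * show "X = mat_power X (Suc n) ** mat_power A n"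
    by metis
qed

text \<open>Both equal \<open>X ** A ** Y\<close>: the power of \<open>A\<close> at the index is
  split off one inverse, and raising its exponent by one brings in the other inverse as a
  factor.\<close>

lemma is_drazin_unique:
  assumes X: "is_drazin A X" and Y: "is_drazin A Y"
  shows "X = Y"
proof -
  let ?n = "mat_index A"
  note X = X[unfolded is_drazin_def] and Y = Y[unfolded is_drazin_def]
  have "X = mat_power X (Suc ?n) ** (mat_power A (Suc ?n) ** Y)"
    using is_drazin_power_eq(1)[of X A] X Y by metis
  also have "\<dots> = X ** A ** Y"
    using is_drazin_power_eq(1)[of X A ?n] X
    by (metis mat_power.simps(2) mat_power_commute matrix_mul_assoc)
  finally have XAY: "X = X ** A ** Y" .
  have "X ** mat_power A (Suc ?n) = mat_power A ?n"
  proof -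
    have "X ** mat_power A j = mat_power A j ** X" for j
      by (induction j) (simp_all, metis X matrix_mul_assoc)
    with X show ?thesis
      by metis
  qed
  then have "Y = X ** mat_power A (Suc ?n) ** mat_power Y (Suc ?n)"
    using is_drazin_power_eq(2)[of Y A] Y by metis
  also have "\<dots> = X ** A ** Y"
    using is_drazin_power_eq(2)[of Y A ?n] Y
    by (metis mat_power.simps(2) matrix_mul_assoc)
  finally show ?thesis
    using XAY by simp
qed

lemma is_drazin_drazin: "is_drazin A (drazin A)"
  unfolding drazin_def
  using is_drazin_exists is_drazin_unique by (metis theI)

theorem theorem3:
  fixes A :: "complex ^ 'n ^ 'n"
  assumes "core_EP A"
  shows "DMP_inverse A = drazin A \<longleftrightarrow> MPD_inverse A = drazin A"
proof -
  define D where "D = drazin A"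
  define M where "M = moore_penrose A"
  have DAD: "D ** A ** D = D" and comm: "A ** D = D ** A"
    using is_drazin_drazin[of A] by (auto simp: is_drazin_def D_def)
  have EP: "M ** (A ** D ** A) = A ** D ** A ** M"
    using assms by (simp add: core_EP_def core_part_def D_def M_def)
  have "M ** A ** D = D" if "D ** A ** M = D"
  proof -
    have "M ** (A ** D ** A) = A ** D"
      using EP that by (metis matrix_mul_assoc)
    then have "M ** (A ** D ** A) ** D = A ** D ** D"
      by simp
    then show ?thesis
      by (metis DAD comm matrix_mul_assoc)
  qed
  moreover have "D ** A ** M = D" if "M ** A ** D = D"
  proof -
    \<comment> \<open>Now the left side of \<open>EP\<close> collapses, and \<open>D\<close> is
      multiplied on from the left.\<close>
    have "A ** D ** A ** M = D ** A"
      using EP that by (metis matrix_mul_assoc)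
    then have "D ** (A ** D ** A ** M) = D ** (D ** A)"
      by simp
    then show ?thesis
      by (metis DAD comm matrix_mul_assoc)
  qed
  ultimately show ?thesis
    unfolding DMP_inverse_def MPD_inverse_def D_def M_def by blast
qed

end
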